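(* Let $d\ge1$, $b>0$, $T>0$, let $\phi_i:[-b,0]\to\mathbb R$ ($1\le i\le d$) be measurable, and let $f_{ij},g_{ij}:\mathbb R^d\to\mathbb R$ ($1\le i,j\le d$) be bounded measurable functions with $f_{ij}\ge0$ for $i\ne j$. Let $\pi:0=t_0<t_1<\dots<t_n=T$ be a partition with $\max_{0\le k\le n-1}(t_{k+1}-t_k)<b$, and let $X^\pi=(X_1^\pi,\dots,X_d^\pi)^T$ and $S^\pi=(S_1^\pi,\dots,S_d^\pi)^T$ be given by the logarithmic Euler–Maruyama scheme defined in the context. If $\phi(0)\ge0$ a.s. (that is, $\phi_i(0)\ge0$ for $i=1,\dots,d$), then $X^\pi(t)\ge0$ a.s. (componentwise), and hence $S^\pi(t)\ge0$ a.s. (componentwise), for all $0\le t\le T$.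
   Context: For $j=1,\dots,d$, $Z_j(t)=\sum_{k=1}^{N_j(t)}Y_{j,k}$, where the $Y_{j,k}$ are i.i.d. random variables and $N_1,\dots,N_d$ are independent Poisson processes which are also independent of the $Y_{j,k}$; the jumps of every $Z_j$ lie in an interval $[-R,\infty)$. Let $F(x)$ be the $d\times d$ matrix with $F_{ii}(x)=0$ and $F_{ij}(x)=f_{ij}(x)$ for $i\ne j$. Put $S_i^\pi(t)=\phi_i(t)$ for $t\in[-b,0]$, $X_i^\pi(0)=\phi_i(0)$, $p^\pi(0)=(1,\dots,1)^T$ and, for $t_k\le t\le t_{k+1}$, $k=0,\dots,n-1$, $$X_i^\pi(t)=X_i^\pi(t_k)\exp\Big(f_{ii}(S^\pi(t_k-b))(t-t_k)+\sum_{j=1}^d\ln\big(1+g_{ij}(S^\pi(t_k-b))\,(Z_j(t)-Z_j(t_k))\big)\Big),$$ $$p^\pi(t)=\big[F(S^\pi(t_k-b))(t-t_k)+I\big]p^\pi(t_k),\qquad S_i^\pi(t)=p_i^\pi(t)\,X_i^\pi(t),$$ where $p^\pi=(p_1^\pi,\dots,p_d^\pi)^T$. *)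

theory Defs
  imports "HOL-Probability.Probability"
begin

text \<open>Homogeneous Poisson process of rate \<open>r\<close>. The sample paths are nondecreasing almost
  surely, so the truncated subtraction on \<^typ>\<open>nat\<close> is the true increment almost surely.\<close>

definition poisson_process :: "'a measure \<Rightarrow> real \<Rightarrow> (real \<Rightarrow> 'a \<Rightarrow> nat) \<Rightarrow> bool" where
  "poisson_process M r N \<longleftrightarrow>
     0 < r \<and>
     (\<forall>t\<ge>0. N t \<in> measurable M (count_space UNIV)) \<and>
     (AE \<omega> in M. N 0 \<omega> = 0) \<and>
     (AE \<omega> in M. mono_on {0..} (\<lambda>t. N t \<omega>)) \<and>
     (AE \<omega> in M. \<forall>t\<ge>0. continuous (at_right t) (\<lambda>s. real (N s \<omega>))) \<and>
     (\<forall>s t. 0 \<le> s \<longrightarrow> s < t \<longrightarrow>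
        distr M (count_space UNIV) (\<lambda>\<omega>. N t \<omega> - N s \<omega>)
          = measure_pmf (poisson_pmf (r * (t - s)))) \<and>
     (\<forall>(n::nat) (u::nat \<Rightarrow> real). 0 \<le> u 0 \<longrightarrow> (\<forall>k<n. u k < u (Suc k)) \<longrightarrow>
        prob_space.indep_vars M (\<lambda>_. count_space UNIV)
          (\<lambda>k \<omega>. N (u (Suc k)) \<omega> - N (u k) \<omega>) {..<n})"

definition compound_sum ::
  "(real \<Rightarrow> 'a \<Rightarrow> nat) \<Rightarrow> (nat \<Rightarrow> 'a \<Rightarrow> real) \<Rightarrow> real \<Rightarrow> 'a \<Rightarrow> real" where
  "compound_sum N Y t \<omega> = (\<Sum>k = 1..N t \<omega>. Y k \<omega>)"

text \<open>The driving noise: the whole double family of the \<open>Y j k\<close> with \<open>k \<ge> 1\<close> is i.i.d.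
  (\<open>Y j 0\<close> is not used), the \<open>N j\<close> are Poisson processes that are independent as processes,
  i.e. as random elements of the path space over \<open>{0..}\<close>, and the family of the \<open>N j\<close> is
  independent of the family of the \<open>Y j k\<close>. The last clause uses generated sigma algebras
  because \<^const>\<open>prob_space.indep_var\<close> needs both variables to have the same value type.\<close>

definition compound_poisson_noise ::
  "'a measure \<Rightarrow> ('d \<Rightarrow> real) \<Rightarrow> ('d \<Rightarrow> real \<Rightarrow> 'a \<Rightarrow> nat) \<Rightarrow> ('d \<Rightarrow> nat \<Rightarrow> 'a \<Rightarrow> real) \<Rightarrow> bool"
where
  "compound_poisson_noise M r N Y \<longleftrightarrow>
     prob_space.indep_vars M (\<lambda>_. borel) (\<lambda>(j, k). Y j k) (UNIV \<times> {1..}) \<and>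
     (\<forall>j j'. \<forall>k\<ge>1. \<forall>k'\<ge>1. distr M borel (Y j k) = distr M borel (Y j' k')) \<and>
     (\<forall>j. poisson_process M (r j) (N j)) \<and>
     prob_space.indep_vars M (\<lambda>_. \<Pi>\<^sub>M t\<in>{0..}. count_space UNIV)
       (\<lambda>j \<omega>. \<lambda>t\<in>{0..}. N j t \<omega>) UNIV \<and>
     prob_space.indep_set M
       (sets (vimage_algebra (space M) (\<lambda>\<omega> j. \<lambda>t\<in>{0..}. N j t \<omega>)
          (\<Pi>\<^sub>M j\<in>UNIV. \<Pi>\<^sub>M t\<in>{0..}. count_space UNIV)))
       (sets (vimage_algebra (space M) (\<lambda>\<omega>. \<lambda>(j, k)\<in>UNIV \<times> {1..}. Y j k \<omega>)
          (\<Pi>\<^sub>M jk\<in>UNIV \<times> {1..}. borel)))"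

definition jump :: "(real \<Rightarrow> real) \<Rightarrow> real \<Rightarrow> real" where
  "jump z t = z t - Lim (at_left t) z"

definition jumps_in :: "(real \<Rightarrow> real) \<Rightarrow> real set \<Rightarrow> bool" where
  "jumps_in z J \<longleftrightarrow> (\<forall>t>0. jump z t \<noteq> 0 \<longrightarrow> jump z t \<in> J)"

definition partition_of :: "real \<Rightarrow> nat \<Rightarrow> (nat \<Rightarrow> real) \<Rightarrow> bool" where
  "partition_of T n \<tau> \<longleftrightarrow> \<tau> 0 = 0 \<and> \<tau> n = T \<and> (\<forall>k<n. \<tau> k < \<tau> (Suc k))"

definition mesh :: "nat \<Rightarrow> (nat \<Rightarrow> real) \<Rightarrow> real" where
  "mesh n \<tau> = Max ((\<lambda>k. \<tau> (Suc k) - \<tau> k) ` {..<n})"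

definition off_diag :: "('d \<Rightarrow> 'd \<Rightarrow> real ^ 'd \<Rightarrow> real) \<Rightarrow> real ^ 'd \<Rightarrow> real ^ 'd ^ 'd" where
  "off_diag f x = (\<chi> i j. if i = j then 0 else f i j x)"

text \<open>\<open>X\<close>, \<open>p\<close>, \<open>S\<close> are the paths produced by the logarithmic Euler--Maruyama scheme from the
  path \<open>z\<close> of the driving noise. Since \<open>-b \<le> \<tau> k - b < \<tau> k\<close>, the equations determine them
  successively on the intervals of the partition; at a common end point the two equations agree.
  The scheme is mathematically meaningful where the arguments of the logarithms are positive.
  That is not imposed here: \<^const>\<open>ln\<close> is total, so these equations also prescribe some path
  elsewhere.\<close>

definition log_euler_maruyama ::
  "real \<Rightarrow> nat \<Rightarrow> (nat \<Rightarrow> real) \<Rightarrow>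
   ('d::finite \<Rightarrow> 'd \<Rightarrow> real ^ 'd \<Rightarrow> real) \<Rightarrow> ('d \<Rightarrow> 'd \<Rightarrow> real ^ 'd \<Rightarrow> real) \<Rightarrow>
   (real \<Rightarrow> real ^ 'd) \<Rightarrow> ('d \<Rightarrow> real \<Rightarrow> real) \<Rightarrow>
   (real \<Rightarrow> real ^ 'd) \<Rightarrow> (real \<Rightarrow> real ^ 'd) \<Rightarrow> (real \<Rightarrow> real ^ 'd) \<Rightarrow> bool"
where
  "log_euler_maruyama b n \<tau> f g \<phi> z X p S \<longleftrightarrow>
     (\<forall>t\<in>{-b..0}. S t = \<phi> t) \<and> X 0 = \<phi> 0 \<and> p 0 = (\<chi> i. 1) \<and>
     (\<forall>k<n. \<forall>t\<in>{\<tau> k..\<tau> (Suc k)}.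
        (\<forall>i. X t $ i = X (\<tau> k) $ i *
           exp (f i i (S (\<tau> k - b)) * (t - \<tau> k) +
                (\<Sum>j\<in>UNIV. ln (1 + g i j (S (\<tau> k - b)) * (z j t - z j (\<tau> k)))))) \<and>
        p t = ((t - \<tau> k) *\<^sub>R off_diag f (S (\<tau> k - b)) + mat 1) *v p (\<tau> k) \<and>
        (\<forall>i. S t $ i = p t $ i * X t $ i))"

end

theory Submission
  imports Defs
begin

text \<open>The logarithmic step multiplies each \<open>X\<^sub>i\<close> by an exponential, and \<open>p\<close> is multiplied by a
  matrix with nonnegative entries; so nonnegativity of \<open>X\<close> and \<open>p\<close>, and of their product \<open>S\<close>,
  propagates pathwise from one interval of the partition to the next.\<close>

lemma matrix_vector_mult_nonneg:
  fixes A :: "real ^ 'n ^ 'm" and x :: "real ^ 'n"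
  assumes "\<And>i j. A $ i $ j \<ge> 0" and "\<And>j. x $ j \<ge> 0"
  shows "(A *v x) $ i \<ge> 0"
  using assms by (simp add: matrix_vector_mult_def sum_nonneg)

text \<open>Pathwise form: \<open>z\<close>, \<open>X\<close>, \<open>p\<close>, \<open>S\<close>
  are the paths of one fixed outcome, so probability enters only when the result is transferred to
  almost every outcome.\<close>

lemma log_euler_maruyama_nonneg:
  fixes f g :: "'d::finite \<Rightarrow> 'd \<Rightarrow> real ^ 'd \<Rightarrow> real"
  assumes scheme: "log_euler_maruyama b n \<tau> f g \<phi> z X p S"
    and part: "partition_of T n \<tau>"
    and "b \<ge> 0"
    and off: "\<And>i j x. i \<noteq> j \<Longrightarrow> f i j x \<ge> 0"
    and init: "\<And>i. \<phi> 0 $ i \<ge> 0"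
    and "t \<in> {0..T}"
  shows "X t $ i \<ge> 0" and "S t $ i \<ge> 0"
proof -
  \<comment> \<open>The induction is over the nodes. \<open>p\<close> is carried along because
    \<open>S\<close> gets its sign from \<open>p\<close> and \<open>X\<close> together.\<close>
  have "k \<le> n \<Longrightarrow> \<forall>t\<in>{0..\<tau> k}. \<forall>i. X t $ i \<ge> 0 \<and> p t $ i \<ge> 0 \<and> S t $ i \<ge> 0" for k
  proof (induction k)
    case 0
    \<comment> \<open>The interval is the single point 0, where \<open>S\<close> is given by the
      history clause: 0 lies in \<open>{-b..0}\<close> since \<open>b \<ge> 0\<close>.\<close>
    have "\<tau> 0 = 0" "X 0 = \<phi> 0" "p 0 = (\<chi> i. 1)" "S 0 = \<phi> 0"
      using scheme part \<open>b \<ge> 0\<close> by (auto simp: log_euler_maruyama_def partition_of_def)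
    then show ?case using init by simp
  next
    case (Suc k)
    then have "k < n" by simp
    have IH: "X t $ i \<ge> 0 \<and> p t $ i \<ge> 0 \<and> S t $ i \<ge> 0" if "0 \<le> t" "t \<le> \<tau> k" for t i
      using Suc that by simp
    have "m \<le> n \<Longrightarrow> 0 \<le> \<tau> m" for m
      using part by (induction m) (auto simp: partition_of_def Suc_le_eq intro: order_trans less_imp_le)
    then have "0 \<le> \<tau> k" using \<open>k < n\<close> by simp
    note node = IH[OF this order_refl]
    show ?case
    proof (intro ballI allI)
      fix t i assume t: "t \<in> {0..\<tau> (Suc k)}"
      show "X t $ i \<ge> 0 \<and> p t $ i \<ge> 0 \<and> S t $ i \<ge> 0"
      proof (cases "t \<le> \<tau> k")
        case True
        then show ?thesis using IH t by simp
      next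
        case False
        \<comment> \<open>The delayed state at which the coefficients are frozen on this cell. The
          off-diagonal \<open>f i j\<close> are nonnegative at every point, so \<open>x\<close> can
          be treated as arbitrary.\<close>
        define x where "x = S (\<tau> k - b)"
        have cell: "t \<in> {\<tau> k..\<tau> (Suc k)}" using False t by simp
        have X: "X t $ i = X (\<tau> k) $ i * exp (f i i x * (t - \<tau> k) +
            (\<Sum>j\<in>UNIV. ln (1 + g i j x * (z j t - z j (\<tau> k)))))"
          and p: "p t = ((t - \<tau> k) *\<^sub>R off_diag f x + mat 1) *v p (\<tau> k)"
          and S: "S t $ i = p t $ i * X t $ i"
          using scheme \<open>k < n\<close> cell unfolding log_euler_maruyama_def x_def by blast+
        have "X t $ i \<ge> 0" unfolding X using node by simp
        \<comment> \<open>The step matrix has diagonal entries 1 and off-diagonal entries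
          \<open>(t - \<tau> k) * f i j x\<close>, nonnegative because
          \<open>t > \<tau> k\<close>.\<close>
        moreover have "p t $ i \<ge> 0" unfolding p
          by (rule matrix_vector_mult_nonneg)
            (use node off False in \<open>auto simp: off_diag_def mat_def\<close>)
        ultimately show ?thesis using S by simp
      qed
    qed
  qed
  from this[of n] show "X t $ i \<ge> 0" and "S t $ i \<ge> 0"
    using part \<open>t \<in> {0..T}\<close> by (auto simp: partition_of_def)
qed

theorem lemma3p2:
  fixes M :: "'a measure" and b T R :: real and n :: nat and \<tau> :: "nat \<Rightarrow> real"
    and f g :: "'d::finite \<Rightarrow> 'd \<Rightarrow> real ^ 'd \<Rightarrow> real"
    and \<phi> :: "real \<Rightarrow> real ^ 'd"
    and r :: "'d \<Rightarrow> real" and N :: "'d \<Rightarrow> real \<Rightarrow> 'a \<Rightarrow> nat" and Y :: "'d \<Rightarrow> nat \<Rightarrow> 'a \<Rightarrow> real"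
    and Z :: "'d \<Rightarrow> real \<Rightarrow> 'a \<Rightarrow> real"
    and X p S :: "real \<Rightarrow> 'a \<Rightarrow> real ^ 'd"
  assumes "prob_space M"
    and "b > 0" and "T > 0"
    and "\<And>i. (\<lambda>t. \<phi> t $ i) \<in> borel_measurable (restrict_space borel {-b..0})"
    and "\<And>i j. f i j \<in> borel_measurable borel" and "\<And>i j. bounded (range (f i j))"
    and "\<And>i j. g i j \<in> borel_measurable borel" and "\<And>i j. bounded (range (g i j))"
    and "\<And>i j x. i \<noteq> j \<Longrightarrow> f i j x \<ge> 0"
    and "compound_poisson_noise M r N Y"
    and "\<And>j t \<omega>. Z j t \<omega> = compound_sum (N j) (Y j) t \<omega>"
    and "AE \<omega> in M. \<forall>j. jumps_in (\<lambda>t. Z j t \<omega>) {-R..}"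
    and "partition_of T n \<tau>" and "mesh n \<tau> < b"
    and "AE \<omega> in M. log_euler_maruyama b n \<tau> f g \<phi> (\<lambda>j t. Z j t \<omega>)
           (\<lambda>t. X t \<omega>) (\<lambda>t. p t \<omega>) (\<lambda>t. S t \<omega>)"
    and "\<And>i. \<phi> 0 $ i \<ge> 0"
  shows "(AE \<omega> in M. \<forall>t\<in>{0..T}. \<forall>i. X t \<omega> $ i \<ge> 0) \<and>
         (AE \<omega> in M. \<forall>t\<in>{0..T}. \<forall>i. S t \<omega> $ i \<ge> 0)"
proof (intro conjI)
  \<comment> \<open>The scheme premise stays open and is discharged outcome by outcome. It concerns
    the whole path, so one null set serves all \<open>t\<close> and \<open>i\<close>.\<close>
  note nonneg = log_euler_maruyama_nonneg[where f = f and \<phi> = \<phi>,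
      OF _ assms(13) less_imp_le[OF assms(2)] assms(9) assms(16)]
  show "AE \<omega> in M. \<forall>t\<in>{0..T}. \<forall>i. X t \<omega> $ i \<ge> 0"
    using assms(15) by (rule eventually_mono) (intro ballI allI, rule nonneg(1))
  show "AE \<omega> in M. \<forall>t\<in>{0..T}. \<forall>i. S t \<omega> $ i \<ge> 0"
    using assms(15) by (rule eventually_mono) (intro ballI allI, rule nonneg(2))
qed

end
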